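(* No one-directed complete bipartite graph is avoidable. That is, if $F$ is an orientation of a complete bipartite graph in which all arcs are directed from one color class to the other, then there is no function $d_F:\mathbb{N}\to\mathbb{N}$ such that for every $k\in\mathbb{N}$, every digraph of minimum out-degree at least $d_F(k)$ contains an $F$-free subdigraph of minimum out-degree at least $k$.
   Context: Digraphs are finite, with non-empty vertex set $V(D)$ and arc set $A(D)\subseteq\{(u,v)\in V(D)^2 : u\ne v\}$ (no loops, no parallel arcs; a pair of opposite arcs is allowed). A digraph is $F$-free if it has no subdigraph (not necessarily induced) isomorphic to $F$. Subdigraphs are not required to be spanning or induced. A digraph $F$ is called avoidable if there exists $d_F:\mathbb{N}\to\mathbb{N}$ such that for every $k$, every digraph of minimum out-degree at least $d_F(k)$ contains an $F$-free subdigraph of minimum out-degree at least $k$. A one-directed complete bipartite graph is an orientation of a (finite) complete bipartite graph all of whose arcs are directed from one color class to the other. *)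

theory Defs
  imports "Graph_Theory.Graph_Theory"
begin

text \<open>
  The locale \<^locale>\<open>pair_digraph\<close> describes finite digraphs whose arcs are ordered pairs of
  distinct vertices; it admits the empty digraph, which is excluded here. The library's coercion
  \<^const>\<open>with_proj\<close> (inserted automatically) gives access to \<^const>\<open>subgraph\<close>,
  \<^const>\<open>digraph_iso\<close> and \<^const>\<open>out_degree\<close>.
\<close>

definition nonempty_digraph :: "'a pair_pre_digraph \<Rightarrow> bool" where
  "nonempty_digraph D \<longleftrightarrow> pair_digraph D \<and> pverts D \<noteq> {}"

definition subdigraph :: "'a pair_pre_digraph \<Rightarrow> 'a pair_pre_digraph \<Rightarrow> bool" where
  "subdigraph H D \<longleftrightarrow> nonempty_digraph H \<and> subgraph H D"

definition free_of :: "'a pair_pre_digraph \<Rightarrow> 'b pair_pre_digraph \<Rightarrow> bool" where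
  "free_of F D \<longleftrightarrow> \<not> (\<exists>H. subdigraph H D \<and> digraph_iso F H)"

definition min_out_degree :: "'a pair_pre_digraph \<Rightarrow> nat" where
  "min_out_degree D = Min (out_degree D ` pverts D)"

text \<open>
  Since digraphs are finite, each is isomorphic to one with vertices in \<^typ>\<open>nat\<close>; quantifying
  over digraphs on \<^typ>\<open>nat\<close> therefore amounts to quantifying over all digraphs.
\<close>

definition avoidable :: "'a pair_pre_digraph \<Rightarrow> bool" where
  "avoidable F \<longleftrightarrow>
     (\<exists>d :: nat \<Rightarrow> nat. \<forall>k. \<forall>D :: nat pair_pre_digraph.
        nonempty_digraph D \<and> min_out_degree D \<ge> d k \<longrightarrow>
        (\<exists>H. subdigraph H D \<and> free_of F H \<and> min_out_degree H \<ge> k))"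

text \<open>
  One of the color classes may be empty; since the vertex set is non-empty, at most one of
  them is.
\<close>

definition one_directed_complete_bipartite :: "'a pair_pre_digraph \<Rightarrow> bool" where
  "one_directed_complete_bipartite F \<longleftrightarrow>
     nonempty_digraph F \<and>
     (\<exists>A B. A \<inter> B = {} \<and> pverts F = A \<union> B \<and> parcs F = A \<times> B)"

end

theory Submission
  imports Defs "HOL-Library.Countable" "HOL-Library.FuncSet"
begin

text \<open>
  Take \<open>d\<close> disjoint complete \<open>d\<close>-ary trees of depth \<open>L\<close>, with arcs directed away from the roots, and
  let every leaf dominate all \<open>d\<close> roots; every vertex then has out-degree \<open>d\<close>. A subdigraph of
  minimum out-degree at least \<open>k\<close> must contain a leaf, hence a root, hence at least \<open>k ^ L\<close> leaves.
  Each of them keeps at least \<open>k\<close> of the \<open>d\<close> roots as out-neighbours, so if \<open>k ^ L \<ge> m * 2 ^ d\<close> then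
  \<open>m\<close> leaves keep the same set of roots, which yields the complete bipartite graph.
\<close>

text \<open>A vertex \<open>(xs, c)\<close> is the node of the \<open>c\<close>-th tree whose path to the root is spelled by \<open>xs\<close>.\<close>

definition forest_verts :: "nat \<Rightarrow> nat \<Rightarrow> (nat list \<times> nat) set" where
  "forest_verts d L = {xs. set xs \<subseteq> {..<d} \<and> length xs \<le> L} \<times> {..<d}"

text \<open>Paths are listed from the node up to the root, so a child prepends one entry and the
  descendants of \<open>xs\<close> are the lists \<open>ys @ xs\<close>.\<close>

fun forest_out :: "nat \<Rightarrow> nat \<Rightarrow> nat list \<times> nat \<Rightarrow> (nat list \<times> nat) set" where
  "forest_out d L (xs, c) =
     (if length xs < L then (\<lambda>x. (x # xs, c)) ` {..<d} else Pair [] ` {..<d})"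

lemma finite_forest_verts: "finite (forest_verts d L)"
  by (simp add: forest_verts_def finite_lists_length_le)

lemma forest_out_subset: "v \<in> forest_verts d L \<Longrightarrow> forest_out d L v \<subseteq> forest_verts d L"
  by (cases v) (auto simp: forest_verts_def)

lemma card_forest_out: "card (forest_out d L v) = d"
  by (cases v) (auto simp: card_image inj_on_def)

text \<open>At depth 0 a root would itself be a leaf and dominate itself; positive depth separates
  leaves from roots.\<close>

lemma forest_out_irrefl: "0 < L \<Longrightarrow> v \<notin> forest_out d L v"
  by (cases v) auto

text \<open>\<open>W\<close> and \<open>N\<close> stand for the vertex set and the
  out-neighbourhoods of a subdigraph of minimum out-degree at least \<open>k\<close>, so that the
  counting can be done on sets alone.\<close>

context
  fixes d L k :: nat and W :: "(nat list \<times> nat) set" and N :: "nat list \<times> nat \<Rightarrow> (nat list \<times> nat) set"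
  assumes W: "W \<subseteq> forest_verts d L"
    and N: "\<And>v. v \<in> W \<Longrightarrow> N v \<subseteq> forest_out d L v \<inter> W"
    and k: "\<And>v. v \<in> W \<Longrightarrow> k \<le> card (N v)"
begin

text \<open>Induction on the height \<open>j\<close> above the leaf level: at least \<open>k\<close>
  children of \<open>xs\<close> survive in \<open>W\<close>, and each has at least
  \<open>k ^ j\<close> surviving leaves below it.\<close>

lemma card_leaves_below:
  assumes "(xs, c) \<in> W" "length xs + j = L"
  shows "k ^ j \<le> card {ys. length ys = j \<and> (ys @ xs, c) \<in> W}"
  using assms
proof (induction j arbitrary: xs)
  case 0
  then show ?case by (simp add: card_gt_0_iff conj_commute cong: conj_cong)
next
  case (Suc j)
  define X where "X = {x. (x # xs, c) \<in> N (xs, c)}"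
  define T where "T x = {ys. length ys = j \<and> (ys @ x # xs, c) \<in> W}" for x
  have fin: "finite {ys. length ys = i \<and> (ys @ zs, c) \<in> W}" for i zs
  proof (rule finite_subset)
    show "{ys. length ys = i \<and> (ys @ zs, c) \<in> W} \<subseteq> {ys. set ys \<subseteq> {..<d} \<and> length ys = i}"
      using W unfolding forest_verts_def by fastforce
  qed (simp add: finite_lists_length_eq)
  have N_eq: "N (xs, c) = (\<lambda>x. (x # xs, c)) ` X"
    using N[OF Suc.prems(1)] Suc.prems(2) by (auto simp: X_def)
  have "finite X"
    using N[OF Suc.prems(1)] Suc.prems(2)
    by (intro finite_subset[of X "{..<d}"]) (auto simp: X_def)
  have "k \<le> card X"
    using k[OF Suc.prems(1)] unfolding N_eq by (simp add: card_image inj_on_def)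
  then have "k ^ Suc j \<le> (\<Sum>x\<in>X. k ^ j)"
    by simp
  also have "\<dots> \<le> (\<Sum>x\<in>X. card (T x))"
  proof (rule sum_mono)
    fix x assume "x \<in> X"
    then show "k ^ j \<le> card (T x)"
      using N[OF Suc.prems(1)] Suc.prems(2) Suc.IH[of "x # xs"] by (auto simp: X_def T_def)
  qed
  \<comment> \<open>The appended entry \<open>x\<close> records the child passed through, which
    makes the sets for different children disjoint.\<close>
  also have "\<dots> = card (\<Union>x\<in>X. (\<lambda>ys. ys @ [x]) ` T x)"
    by (subst card_UN_disjoint) (use fin \<open>finite X\<close> in \<open>auto simp: T_def card_image inj_on_def\<close>)
  also have "\<dots> \<le> card {ys. length ys = Suc j \<and> (ys @ xs, c) \<in> W}"
    by (rule card_mono[OF fin]) (auto simp: T_def)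
  finally show ?case .
qed

lemma leaf_exists:
  assumes "0 < k" "(xs, c) \<in> W"
  shows "\<exists>ys. length ys = L \<and> (ys, c) \<in> W"
proof -
  have "length xs \<le> L"
    using assms W by (auto simp: forest_verts_def)
  then have "k ^ (L - length xs) \<le>
      card {ys. length ys = L - length xs \<and> (ys @ xs, c) \<in> W}" (is "_ \<le> card ?S")
    by (intro card_leaves_below assms) simp
  then have "?S \<noteq> {}"
    using assms(1) by (metis card.empty leD zero_less_power)
  then obtain ys where "length ys = L - length xs" "(ys @ xs, c) \<in> W"
    by blast
  with \<open>length xs \<le> L\<close> show ?thesis
    by (intro exI[of _ "ys @ xs"]) simp
qed

lemma forest_common_out_neighbours:
  assumes "W \<noteq> {}" "0 < k" "0 < m" "m * 2 ^ d \<le> k ^ L"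
  shows "\<exists>A B. A \<subseteq> W \<and> m \<le> card A \<and> k \<le> card B \<and> (\<forall>a\<in>A. N a = B)"
proof -
  from assms(1,2) obtain zs c' where leaf: "length zs = L" "(zs, c') \<in> W"
    using leaf_exists by fastforce
  \<comment> \<open>Out-neighbours of a leaf are roots, so a leaf in \<open>W\<close> forces a root
    into \<open>W\<close>.\<close>
  with k assms(2) have "N (zs, c') \<noteq> {}"
    by fastforce
  with N[OF leaf(2)] leaf(1) obtain c where root: "([], c) \<in> W"
    by auto
  define S where "S = (\<lambda>ys. (ys, c)) ` {ys. length ys = L \<and> (ys, c) \<in> W}"
  have "S \<subseteq> W"
    by (auto simp: S_def)
  then have "finite S"
    using W finite_forest_verts finite_subset by metis
  have "k ^ L \<le> card S"
    using card_leaves_below[OF root, of L] by (simp add: S_def card_image inj_on_def)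
  \<comment> \<open>All leaves have the same \<open>d\<close> candidate out-neighbours, so
    \<open>N\<close> takes at most \<open>2 ^ d\<close> values on \<open>S\<close>, and some fibre
    reaches the average size.\<close>
  moreover have "N ` S \<subseteq> Pow (Pair [] ` {..<d})"
    using N by (fastforce simp: S_def)
  moreover have "card (Pow (Pair [] ` {..<d} :: (nat list \<times> nat) set)) = 2 ^ d"
    by (simp add: card_Pow card_image inj_on_def)
  ultimately obtain B where "card S \<le> card (N -` {B} \<inter> S) * 2 ^ d"
    using pigeonhole_card[of N S "Pow (Pair [] ` {..<d})"] \<open>finite S\<close>
    by (auto simp: image_subset_iff_funcset)
  with \<open>k ^ L \<le> card S\<close> assms(4) have "m * 2 ^ d \<le> card (N -` {B} \<inter> S) * 2 ^ d"
    by linarith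
  then have B: "m \<le> card {a \<in> S. N a = B}"
    by (simp add: vimage_def Int_def conj_commute)
  \<comment> \<open>A nonempty fibre makes \<open>B\<close> an actual out-neighbourhood, which
    bounds its size from below.\<close>
  with assms(3) have "{a \<in> S. N a = B} \<noteq> {}"
    by force
  then obtain a where "a \<in> S" "N a = B"
    by blast
  with k \<open>S \<subseteq> W\<close> have "k \<le> card B"
    by blast
  with B \<open>S \<subseteq> W\<close> show ?thesis
    by (intro exI[of _ "{a \<in> S. N a = B}"] exI[of _ B]) auto
qed

end

text \<open>\<open>avoidable\<close> ranges over digraphs on the natural numbers, hence the encoding
  by the injection \<open>to_nat\<close>.\<close>

definition forest_digraph :: "nat \<Rightarrow> nat \<Rightarrow> nat pair_pre_digraph" where
  "forest_digraph d L =
     \<lparr>pverts = to_nat ` forest_verts d L,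
      parcs = map_prod to_nat to_nat ` Sigma (forest_verts d L) (forest_out d L)\<rparr>"

lemma nonempty_forest_digraph:
  assumes "0 < d" "0 < L"
  shows "nonempty_digraph (forest_digraph d L)"
  unfolding nonempty_digraph_def
proof
  have "finite (Sigma (forest_verts d L) (forest_out d L))"
    using finite_forest_verts finite_subset[OF forest_out_subset] by (intro finite_SigmaI) auto
  moreover have "v \<in> forest_verts d L \<and> w \<in> forest_verts d L \<and> v \<noteq> w"
    if "v \<in> forest_verts d L" "w \<in> forest_out d L v" for v w
    using that forest_out_subset[of v d L] forest_out_irrefl[OF assms(2), of v d] by blast
  ultimately show "pair_digraph (forest_digraph d L)"
    using finite_forest_verts[of d L]
    by unfold_locales (fastforce simp: forest_digraph_def simp del: forest_out.simps)+
  show "pverts (forest_digraph d L) \<noteq> {}"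
    using assms(1) by (auto simp: forest_digraph_def forest_verts_def intro!: exI[of _ "[]"])
qed

lemma min_out_degree_ge_iff:
  fixes D :: "'a pair_pre_digraph"
  assumes "nonempty_digraph D"
  shows "k \<le> min_out_degree D \<longleftrightarrow> (\<forall>v\<in>pverts D. k \<le> out_degree D v)"
proof -
  have "finite (pverts D)" "pverts D \<noteq> {}"
    using assms by (auto simp: nonempty_digraph_def pair_digraph_def intro: pair_fin_digraph.pair_finite_verts)
  then show ?thesis
    by (simp add: min_out_degree_def)
qed

text \<open>Every arc of \<open>H\<close> has an encoded forest vertex as its head, so counting
  decoded heads counts all arcs leaving a vertex.\<close>

lemma out_degree_subset_forest:
  fixes H :: "nat pair_pre_digraph" and v :: "nat list \<times> nat"
  assumes "parcs H \<subseteq> parcs (forest_digraph d L)"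
  shows "out_degree H (to_nat v) = card {w :: nat list \<times> nat. (to_nat v, to_nat w) \<in> parcs H}"
proof -
  have "out_arcs H (to_nat v) = (\<lambda>w. (to_nat v, to_nat w)) `
      {w :: nat list \<times> nat. (to_nat v, to_nat w) \<in> parcs H}"
    using assms by (auto simp: out_arcs_def forest_digraph_def)
  then show ?thesis
    by (simp add: out_degree_def card_image inj_on_def)
qed

lemma min_out_degree_forest_digraph:
  assumes "0 < d" "0 < L"
  shows "d \<le> min_out_degree (forest_digraph d L)"
proof -
  have "d \<le> out_degree (forest_digraph d L) (to_nat v)" if "v \<in> forest_verts d L" for v
  proof -
    have "{w. (to_nat v, to_nat w) \<in> parcs (forest_digraph d L)} = forest_out d L v"
      using that by (auto simp: forest_digraph_def)
    then show ?thesis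
      by (simp add: out_degree_subset_forest[OF order_refl] card_forest_out)
  qed
  then show ?thesis
    unfolding min_out_degree_ge_iff[OF nonempty_forest_digraph[OF assms]]
    by (auto simp: forest_digraph_def)
qed

lemma subdigraph_forest_common_out_neighbours:
  assumes H: "subdigraph H (forest_digraph d L)" "k \<le> min_out_degree H"
    and "0 < k" "0 < m" "m * 2 ^ d \<le> k ^ L"
  shows "\<exists>A B. A \<subseteq> pverts H \<and> m \<le> card A \<and> k \<le> card B \<and> A \<times> B \<subseteq> parcs H"
proof -
  define W :: "(nat list \<times> nat) set" where "W = {v. to_nat v \<in> pverts H}"
  define N :: "nat list \<times> nat \<Rightarrow> (nat list \<times> nat) set"
    where "N v = {w. (to_nat v, to_nat w) \<in> parcs H}" for v
  have sub: "pverts H \<subseteq> pverts (forest_digraph d L)" "parcs H \<subseteq> parcs (forest_digraph d L)"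
    and ne: "nonempty_digraph H"
    using H(1) by (auto simp: subdigraph_def subgraph_def)
  interpret H: pair_digraph H
    using ne by (simp add: nonempty_digraph_def)
  have "\<exists>A B. A \<subseteq> W \<and> m \<le> card A \<and> k \<le> card B \<and> (\<forall>a\<in>A. N a = B)"
  proof (rule forest_common_out_neighbours)
    show "W \<subseteq> forest_verts d L"
      using sub(1) by (auto simp: W_def forest_digraph_def)
    show "N v \<subseteq> forest_out d L v \<inter> W" for v
      using sub(2) by (auto simp: N_def W_def forest_digraph_def dest: H.in_arcsD2)
    show "k \<le> card (N v)" if "v \<in> W" for v
      using that H(2) unfolding min_out_degree_ge_iff[OF ne]
      by (auto simp: W_def N_def out_degree_subset_forest[OF sub(2)])
    show "W \<noteq> {}"
      using ne sub(1) by (fastforce simp: W_def nonempty_digraph_def forest_digraph_def)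
  qed (fact assms)+
  then obtain A B where AB: "A \<subseteq> W" "m \<le> card A" "k \<le> card B" "\<And>a. a \<in> A \<Longrightarrow> N a = B"
    by blast
  show ?thesis
  proof (intro exI conjI)
    show "to_nat ` A \<subseteq> pverts H" "to_nat ` A \<times> to_nat ` B \<subseteq> parcs H"
      using AB by (auto simp: W_def N_def)
    show "m \<le> card (to_nat ` A)" "k \<le> card (to_nat ` B)"
      using AB by (simp_all add: card_image)
  qed
qed

text \<open>Injections of \<open>A\<close> into \<open>A'\<close> and of \<open>B\<close> into
  \<open>B'\<close> glue to an embedding \<open>h\<close> of \<open>F\<close>, whose image
  \<open>K\<close> is the required copy.\<close>

lemma not_free_of_complete_bipartite:
  assumes F: "nonempty_digraph F" "pverts F = A \<union> B" "parcs F = A \<times> B" "A \<inter> B = {}"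
    and H: "nonempty_digraph H" "A' \<union> B' \<subseteq> pverts H" "A' \<times> B' \<subseteq> parcs H"
    and card: "card A \<le> card A'" "card B \<le> card B'"
  shows "\<not> free_of F H"
proof -
  interpret F: pair_digraph F
    using F(1) by (simp add: nonempty_digraph_def)
  interpret H: pair_digraph H
    using H(1) by (simp add: nonempty_digraph_def)
  have "finite A" "finite B"
    using F.pair_finite_verts F(2) by auto
  moreover have "finite A'" "finite B'"
    using finite_subset[OF H(2) H.pair_finite_verts] by auto
  ultimately obtain f g where f: "f ` A \<subseteq> A'" "inj_on f A" and g: "g ` B \<subseteq> B'" "inj_on g B"
    using card card_le_inj[of A A'] card_le_inj[of B B'] by blast
  \<comment> \<open>A common vertex would carry a loop of \<open>H\<close>.\<close>
  have disj: "A' \<inter> B' = {}"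
    using H(3) H.no_loops' by blast
  define h where "h x = (if x \<in> A then f x else g x)" for x
  have hA: "h x \<in> A'" if "x \<in> A" for x
    using that f by (auto simp: h_def)
  have hB: "h x \<in> B'" if "x \<in> B" for x
    using that g F(4) by (auto simp: h_def)
  have inj: "inj_on h (A \<union> B)"
    unfolding inj_on_Un
  proof (intro conjI)
    show "inj_on h A"
      using f(2) by (simp add: h_def cong: inj_on_cong)
    have "h x = g x" if "x \<in> B" for x
      using that F(4) by (auto simp: h_def)
    with g(2) show "inj_on h B"
      by (simp cong: inj_on_cong)
    show "h ` (A - B) \<inter> h ` (B - A) = {}"
    proof -
      have "h ` (A - B) \<subseteq> A'" "h ` (B - A) \<subseteq> B'"
        using hA hB by auto
      with disj show ?thesis
        by blast
    qed
  qed
  define K where "K = \<lparr>pverts = h ` pverts F, parcs = map_prod h h ` parcs F\<rparr>"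
  have sub: "pverts K \<subseteq> pverts H" "parcs K \<subseteq> parcs H"
    using hA hB H(2,3) by (auto simp: K_def F(2,3))
  have "pair_digraph K"
  proof unfold_locales
    show "finite (pverts K)" "finite (parcs K)"
      using F.pair_finite_verts F.pair_finite_arcs by (auto simp: K_def)
    show "fst e \<noteq> snd e" if "e \<in> parcs K" for e
      using that sub(2) H.pair_no_loops by blast
  qed (auto simp: K_def dest: F.in_arcsD1 F.in_arcsD2)
  then interpret K: pair_digraph K .
  have "subdigraph K H"
    using sub F(1) \<open>pair_digraph K\<close> K.wf_digraph H.wf_digraph
    by (auto simp: subdigraph_def nonempty_digraph_def subgraph_def compatible_def K_def)
  moreover have "digraph_iso F K"
    unfolding digraph_iso_def
  proof (intro exI conjI)
    let ?h = "\<lparr>iso_verts = h, iso_arcs = map_prod h h, iso_head = snd, iso_tail = fst\<rparr>"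
    have "inj_on (map_prod h h) (parcs F)"
      using inj unfolding F(3) by (auto simp: inj_on_def)
    then show "pre_digraph.digraph_isomorphism F ?h"
      using inj F.wf_digraph by (simp add: F.digraph_isomorphism_def F(2))
    show "with_proj K = app_iso ?h F"
      by (simp add: app_iso_def with_proj_def K_def)
  qed
  ultimately show ?thesis
    by (auto simp: free_of_def)
qed

theorem theorem1p3:
  fixes F :: "'a pair_pre_digraph"
  assumes "one_directed_complete_bipartite F"
  shows "\<not> avoidable F"
proof
  assume "avoidable F"
  then obtain dF where dF: "\<And>k D. nonempty_digraph (D :: nat pair_pre_digraph) \<Longrightarrow>
      dF k \<le> min_out_degree D \<Longrightarrow>
      \<exists>H. subdigraph H D \<and> free_of F H \<and> k \<le> min_out_degree H"
    unfolding avoidable_def by blast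
  from assms obtain A B where F: "nonempty_digraph F" "pverts F = A \<union> B" "parcs F = A \<times> B" "A \<inter> B = {}"
    unfolding one_directed_complete_bipartite_def by blast
  \<comment> \<open>\<open>k\<close> is at least \<open>card B\<close> for the embedding and at
    least 2, so that \<open>k ^ L\<close> dominates \<open>2 ^ L\<close>. The successors keep
    \<open>m\<close> and \<open>d\<close> positive even if \<open>A\<close> is empty or
    \<open>dF k = 0\<close>. The choice of \<open>L\<close> gives
    \<open>m * 2 ^ d \<le> 2 ^ m * 2 ^ d = 2 ^ L\<close>.\<close>
  define k where "k = card B + 2"
  define m where "m = Suc (card A)"
  define d where "d = Suc (dF k)"
  define L where "L = m + d"
  have pos: "0 < d" "0 < L" "0 < k" "0 < m"
    by (simp_all add: d_def L_def k_def m_def)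
  have "dF k \<le> min_out_degree (forest_digraph d L)"
    using min_out_degree_forest_digraph[OF pos(1,2)] by (simp add: d_def)
  then obtain H where H: "subdigraph H (forest_digraph d L)" "free_of F H" "k \<le> min_out_degree H"
    using dF nonempty_forest_digraph[OF pos(1,2)] by blast
  have "m * 2 ^ d \<le> (2 :: nat) ^ L"
    by (simp add: L_def power_add less_imp_le)
  also have "\<dots> \<le> k ^ L"
    by (simp add: k_def power_mono)
  finally obtain A' B' where AB: "A' \<subseteq> pverts H" "m \<le> card A'" "k \<le> card B'" "A' \<times> B' \<subseteq> parcs H"
    using subdigraph_forest_common_out_neighbours[OF H(1,3) pos(3,4)] by blast
  have ne: "nonempty_digraph H"
    using H(1) by (simp add: subdigraph_def)
  then interpret H': pair_digraph H
    by (simp add: nonempty_digraph_def)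
  have "\<not> free_of F H"
  proof (rule not_free_of_complete_bipartite[OF F ne])
    \<comment> \<open>Arcs from one fixed \<open>a\<close> to all of \<open>B'\<close> show that
      \<open>B'\<close> consists of vertices of \<open>H\<close>.\<close>
    obtain a where "a \<in> A'"
      using AB(2) pos(4) by fastforce
    then show "A' \<union> B' \<subseteq> pverts H"
      using AB(1,4) H'.in_arcsD2 by blast
  qed (use AB in \<open>auto simp: m_def k_def\<close>)
  with H(2) show False
    by contradiction
qed

end
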